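(* Let $G$ be a group and let $A$ be an infinite subset of $G$. The following statements hold: (i) $A$ is thick if and only if there exists $p\in G^*$ such that $\Delta_p(A)=Gp$; (ii) $A$ is prethick if and only if there exist $p\in G^*$ and a finite subset $F$ of $G$ such that $\Delta_p(FA)=Gp$; (iii) $A$ is small if and only if, for every $p\in G^*$ and each finite subset $F$ of $G$, we have $\Delta_p(FA)\neq Gp$; (iv) $A$ is thin if and only if $|\Delta_p(A)|\leq 1$ for each $p\in G^*$.
   Context: $G$ is a discrete group with identity $e$. $\beta G$ is the Stone-Čech compactification of $G$, whose points are the ultrafilters on $G$ (points of $G$ being identified with principal ultrafilters), with base of open sets $\overline{A}=\{p\in\beta G: A\in p\}$, $A\subseteq G$. $G^*=\beta G\setminus G$ is the set of free ultrafilters on $G$, and $A^*=\overline{A}\cap G^*$ for $A\subseteq G$. For $g\in G$ and $p\in\beta G$, $gp$ is the ultrafilter $\{B\subseteq G: g^{-1}B\in p\}$, and $Gp=\{gp:g\in G\}$. For $A\subseteq G$ and $p\in G^*$, the $p$-companion of $A$ is $\Delta_p(A)=A^*\cap Gp=\{gp: g\in G,\ A\in gp\}$. For $F\subseteq G$, $FA=\{fa:f\in F,a\in A\}$. A subset $A$ of $G$ is called: large if $G=FA$ for some finite subset $F$ of $G$; thick if, for every finite subset $F$ of $G$, there exists $a\in A$ such that $Fa\subseteq A$; prethick if $FA$ is thick for some finite subset $F$ of $G$; small if $L\setminus A$ is large for every large subset $L$ of $G$; thin if $gA\cap A$ is finite for each $g\in G\setminus\{e\}$. *)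

theory Defs
  imports "HOL-Algebra.Coset"
begin

text \<open>
  Products of subsets are those of \<open>HOL-Algebra\<close>: in multiplicative notation, \<open>F <#>\<^bsub>G\<^esub> A\<close> is \<open>FA\<close>,
  \<open>g <#\<^bsub>G\<^esub> A\<close> is \<open>gA\<close> and \<open>F #>\<^bsub>G\<^esub> a\<close> is \<open>Fa\<close>.
\<close>

section \<open>Ultrafilters on a set\<close>

text \<open>
  Ultrafilters are families of subsets of a carrier set \<open>X\<close>, which need not be the whole type.
\<close>

definition ultrafilter_on :: "'a set \<Rightarrow> 'a set set \<Rightarrow> bool" where
  "ultrafilter_on X p \<longleftrightarrow>
     p \<subseteq> Pow X \<and> X \<in> p \<and> {} \<notin> p \<and>
     (\<forall>A\<in>p. \<forall>B\<in>p. A \<inter> B \<in> p) \<and>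
     (\<forall>A\<in>p. \<forall>B. A \<subseteq> B \<and> B \<subseteq> X \<longrightarrow> B \<in> p) \<and>
     (\<forall>A. A \<subseteq> X \<longrightarrow> A \<in> p \<or> X - A \<in> p)"

definition principal_ultrafilter :: "'a set \<Rightarrow> 'a \<Rightarrow> 'a set set" where
  "principal_ultrafilter X x = {B. B \<subseteq> X \<and> x \<in> B}"

text \<open>
  The points of the Stone--Cech compactification of the discrete space \<open>X\<close>; its topology is
  not needed here.
\<close>

definition stone_cech :: "'a set \<Rightarrow> 'a set set set" where
  "stone_cech X = {p. ultrafilter_on X p}"

definition free_ultrafilters :: "'a set \<Rightarrow> 'a set set set" where
  "free_ultrafilters X = stone_cech X - principal_ultrafilter X ` X"

text \<open>The set \<open>A\<^sup>*\<close> for \<open>A \<subseteq> X\<close>.\<close>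

definition free_ultrafilters_containing :: "'a set \<Rightarrow> 'a set \<Rightarrow> 'a set set set" where
  "free_ultrafilters_containing X A = {p \<in> stone_cech X. A \<in> p} \<inter> free_ultrafilters X"

section \<open>The action of a group on its ultrafilters\<close>

definition translate_ultrafilter ::
    "('a, 'b) monoid_scheme \<Rightarrow> 'a \<Rightarrow> 'a set set \<Rightarrow> 'a set set" where
  "translate_ultrafilter G g p = {B. B \<subseteq> carrier G \<and> (inv\<^bsub>G\<^esub> g) <#\<^bsub>G\<^esub> B \<in> p}"

definition ultrafilter_orbit ::
    "('a, 'b) monoid_scheme \<Rightarrow> 'a set set \<Rightarrow> 'a set set set" where
  "ultrafilter_orbit G p = (\<lambda>g. translate_ultrafilter G g p) ` carrier G"

text \<open>The \<open>p\<close>-companion \<open>\<Delta>\<^sub>p(A) = A\<^sup>* \<inter> Gp\<close>.\<close>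

definition companion ::
    "('a, 'b) monoid_scheme \<Rightarrow> 'a set set \<Rightarrow> 'a set \<Rightarrow> 'a set set set" where
  "companion G p A = free_ultrafilters_containing (carrier G) A \<inter> ultrafilter_orbit G p"

section \<open>Size of subsets of a group\<close>

text \<open>These predicates are meant for subsets \<open>A\<close> of \<open>carrier G\<close>.\<close>

definition large :: "('a, 'b) monoid_scheme \<Rightarrow> 'a set \<Rightarrow> bool" where
  "large G A \<longleftrightarrow> (\<exists>F. finite F \<and> F \<subseteq> carrier G \<and> carrier G = F <#>\<^bsub>G\<^esub> A)"

definition thick :: "('a, 'b) monoid_scheme \<Rightarrow> 'a set \<Rightarrow> bool" where
  "thick G A \<longleftrightarrow> (\<forall>F. finite F \<and> F \<subseteq> carrier G \<longrightarrow> (\<exists>a\<in>A. F #>\<^bsub>G\<^esub> a \<subseteq> A))"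

definition prethick :: "('a, 'b) monoid_scheme \<Rightarrow> 'a set \<Rightarrow> bool" where
  "prethick G A \<longleftrightarrow> (\<exists>F. finite F \<and> F \<subseteq> carrier G \<and> thick G (F <#>\<^bsub>G\<^esub> A))"

definition small :: "('a, 'b) monoid_scheme \<Rightarrow> 'a set \<Rightarrow> bool" where
  "small G A \<longleftrightarrow> (\<forall>L. L \<subseteq> carrier G \<and> large G L \<longrightarrow> large G (L - A))"

definition thin :: "('a, 'b) monoid_scheme \<Rightarrow> 'a set \<Rightarrow> bool" where
  "thin G A \<longleftrightarrow> (\<forall>g \<in> carrier G - {\<one>\<^bsub>G\<^esub>}. finite ((g <#\<^bsub>G\<^esub> A) \<inter> A))"

end

theory Submission
  imports Defs
begin

text \<open>
  Membership of \<open>A\<close> in \<open>gp\<close> says that \<open>{x. gx \<in> A}\<close> belongs to \<open>p\<close>. So \<open>\<Delta>\<^sub>p(A) = Gp\<close> says that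
  all these sets, for \<open>g\<close> in \<open>G\<close>, lie in the one ultrafilter \<open>p\<close>; and a free ultrafilter
  containing a given family exists exactly when all finite intersections of the family are
  infinite (\<open>free_ultrafilter_extending\<close>, \<open>free_ultrafilter_iff_members_infinite\<close>). The finite
  intersections here are the sets \<open>{x. Fx \<subseteq> A}\<close> with \<open>F\<close> finite, and thickness of \<open>A\<close> says that
  they are nonempty. In an infinite group they are then infinite, because thickness may be applied
  to \<open>FH\<close> with a finite \<open>H\<close> of any size (\<open>thick_infinitely_many\<close>). This gives the claim about thick
  sets, and applying it to \<open>FA\<close> with \<open>F\<close> nonempty gives the claim about prethick sets.

  The claim about small sets follows because small means not prethick
  (\<open>small_iff_not_prethick\<close>). This rests on the duality between large and thick sets: a set is
  large exactly when its complement is not thick.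

  For thin sets, two different translates \<open>gp\<close> and \<open>hp\<close> both containing \<open>A\<close> put the
  set \<open>{x. gx \<in> A \<and> hx \<in> A}\<close> into \<open>p\<close>; this set is infinite and is carried by \<open>g\<close> into
  \<open>gh\<^sup>-\<^sup>1A \<inter> A\<close>. Conversely, if \<open>gA \<inter> A\<close> is infinite with \<open>g \<noteq> e\<close>, then it has an infinite subset \<open>C\<close>
  disjoint from \<open>gC\<close> (\<open>infinite_displaced_subset\<close>), and for any free ultrafilter \<open>q\<close>
  containing \<open>C\<close> the ultrafilters \<open>q\<close> and \<open>g\<^sup>-\<^sup>1q\<close> are different members of \<open>\<Delta>\<^sub>q(A)\<close>.
\<close>

section \<open>Free ultrafilters on a set\<close>

lemma ultrafilter_onD:
  assumes "ultrafilter_on X p"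
  shows ultrafilter_subset: "A \<in> p \<Longrightarrow> A \<subseteq> X"
    and ultrafilter_carrier: "X \<in> p"
    and ultrafilter_empty: "{} \<notin> p"
    and ultrafilter_Int: "\<lbrakk>A \<in> p; B \<in> p\<rbrakk> \<Longrightarrow> A \<inter> B \<in> p"
    and ultrafilter_mono: "\<lbrakk>A \<in> p; A \<subseteq> B; B \<subseteq> X\<rbrakk> \<Longrightarrow> B \<in> p"
    and ultrafilter_dichotomy: "A \<subseteq> X \<Longrightarrow> A \<in> p \<or> X - A \<in> p"
proof -
  note conjs = assms[unfolded ultrafilter_on_def]
  show "A \<in> p \<Longrightarrow> A \<subseteq> X" using conjs[THEN conjunct1] by blast
  note conjs = conjs[THEN conjunct2]
  show "X \<in> p" using conjs[THEN conjunct1] .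
  note conjs = conjs[THEN conjunct2]
  show "{} \<notin> p" using conjs[THEN conjunct1] .
  note conjs = conjs[THEN conjunct2]
  show "\<lbrakk>A \<in> p; B \<in> p\<rbrakk> \<Longrightarrow> A \<inter> B \<in> p" using conjs[THEN conjunct1] by simp
  note conjs = conjs[THEN conjunct2]
  show "\<lbrakk>A \<in> p; A \<subseteq> B; B \<subseteq> X\<rbrakk> \<Longrightarrow> B \<in> p" using conjs[THEN conjunct1] by simp
  show "A \<subseteq> X \<Longrightarrow> A \<in> p \<or> X - A \<in> p" using conjs[THEN conjunct2] by simp
qed

lemma ultrafilter_finite_Inter:
  assumes "ultrafilter_on X p" "finite \<F>" "\<F> \<subseteq> p"
  shows "X \<inter> \<Inter>\<F> \<in> p"
  using assms(2,3)
proof (induction \<F>)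
  case empty
  then show ?case using ultrafilter_carrier[OF assms(1)] by simp
next
  case (insert B \<F>)
  then have "B \<in> p" "X \<inter> \<Inter>\<F> \<in> p" by auto
  then have "B \<inter> (X \<inter> \<Inter>\<F>) \<in> p" by (rule ultrafilter_Int[OF assms(1)])
  then show ?case by (simp add: Int_left_commute)
qed

text \<open>
  A finite member of an ultrafilter forces a singleton into it, since the complements of
  finitely many points intersect in a set that misses the finite member.
\<close>

lemma free_ultrafilter_iff_members_infinite:
  "p \<in> free_ultrafilters X \<longleftrightarrow> ultrafilter_on X p \<and> (\<forall>B\<in>p. infinite B)"
proof
  assume p: "p \<in> free_ultrafilters X"
  then have u: "ultrafilter_on X p" by (simp add: free_ultrafilters_def stone_cech_def)
  have no_singleton: "{x} \<notin> p" for x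
  proof
    assume x: "{x} \<in> p"
    have "x \<in> B" if "B \<in> p" for B
    proof (rule ccontr)
      assume "x \<notin> B"
      then have "{x} \<inter> B = {}" by simp
      then show False using ultrafilter_Int[OF u x that] ultrafilter_empty[OF u] by simp
    qed
    moreover have "B \<in> p" if "B \<subseteq> X" "x \<in> B" for B
      using ultrafilter_mono[OF u x] that by blast
    ultimately have "p = principal_ultrafilter X x"
      using ultrafilter_subset[OF u] unfolding principal_ultrafilter_def by blast
    moreover have "x \<in> X" using ultrafilter_subset[OF u x] by blast
    ultimately show False using p by (auto simp: free_ultrafilters_def)
  qed
  have "infinite B" if B: "B \<in> p" for B
  proof
    assume fin: "finite B"
    have sub: "B \<subseteq> X" using ultrafilter_subset[OF u B] .
    have "X - {x} \<in> p" if "x \<in> B" for x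
      using ultrafilter_dichotomy[OF u, of "{x}"] no_singleton[of x] sub that by blast
    then have "X \<inter> \<Inter>((\<lambda>x. X - {x}) ` B) \<in> p"
      using ultrafilter_finite_Inter[OF u, of "(\<lambda>x. X - {x}) ` B"] fin by blast
    then have "B \<inter> (X \<inter> \<Inter>((\<lambda>x. X - {x}) ` B)) \<in> p"
      by (rule ultrafilter_Int[OF u B])
    moreover have "B \<inter> (X \<inter> \<Inter>((\<lambda>x. X - {x}) ` B)) = {}" by blast
    ultimately show False using ultrafilter_empty[OF u] by simp
  qed
  then show "ultrafilter_on X p \<and> (\<forall>B\<in>p. infinite B)" using u by blast
next
  assume p: "ultrafilter_on X p \<and> (\<forall>B\<in>p. infinite B)"
  have "p \<noteq> principal_ultrafilter X x" if "x \<in> X" for x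
  proof -
    have "{x} \<in> principal_ultrafilter X x" using that by (simp add: principal_ultrafilter_def)
    then show ?thesis using p by fastforce
  qed
  then show "p \<in> free_ultrafilters X"
    using p by (auto simp: free_ultrafilters_def stone_cech_def)
qed

text \<open>
  Having infinite finite intersections is a property of finite character, so Zorn's lemma gives
  a maximal family with it. Maximality puts into the family every set that meets all its finite
  intersections in an infinite set, and of a set and its complement at least one does so.
\<close>

lemma free_ultrafilter_extending:
  assumes "\<S> \<subseteq> Pow X"
    and "\<And>\<F>. \<lbrakk>finite \<F>; \<F> \<subseteq> \<S>\<rbrakk> \<Longrightarrow> infinite (X \<inter> \<Inter>\<F>)"
  obtains p where "p \<in> free_ultrafilters X" "\<S> \<subseteq> p"
proof -
  define Q where "Q = {p. \<S> \<subseteq> p \<and> p \<subseteq> Pow X \<and>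
    (\<forall>\<F>. finite \<F> \<and> \<F> \<subseteq> p \<longrightarrow> infinite (X \<inter> \<Inter>\<F>))}"
  have "\<exists>M\<in>Q. \<forall>p\<in>Q. M \<subseteq> p \<longrightarrow> p = M"
  proof (rule subset_Zorn_nonempty)
    have "\<S> \<in> Q" using assms by (simp add: Q_def)
    then show "Q \<noteq> {}" by blast
  next
    fix \<C> assume ne: "\<C> \<noteq> {}" and chain: "subset.chain Q \<C>"
    have Q: "\<S> \<subseteq> p" "p \<subseteq> Pow X" if "p \<in> \<C>" for p
      using chain that by (auto simp: subset.chain_def Q_def)
    have "infinite (X \<inter> \<Inter>\<F>)" if fin: "finite \<F>" and sub: "\<F> \<subseteq> \<Union>\<C>" for \<F>
    proof -
      obtain p where "p \<in> \<C>" "\<F> \<subseteq> p"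
        using finite_subset_Union_chain[OF fin sub ne chain] .
      then show ?thesis using chain fin unfolding subset.chain_def Q_def by blast
    qed
    moreover have "\<S> \<subseteq> \<Union>\<C>" using ne Q(1) by (metis Union_upper all_not_in_conv subset_trans)
    moreover have "\<Union>\<C> \<subseteq> Pow X" by (rule Union_least) (rule Q(2))
    ultimately show "\<Union>\<C> \<in> Q" by (simp add: Q_def)
  qed
  then obtain p where p: "p \<in> Q" and max: "\<And>q. \<lbrakk>q \<in> Q; p \<subseteq> q\<rbrakk> \<Longrightarrow> q = p" by blast
  have inf: "infinite (X \<inter> \<Inter>\<F>)" if "finite \<F>" "\<F> \<subseteq> p" for \<F>
    using p that by (auto simp: Q_def)
  have member: "C \<in> p"
    if C: "C \<subseteq> X" and meets: "\<And>\<F>. \<lbrakk>finite \<F>; \<F> \<subseteq> p\<rbrakk> \<Longrightarrow> infinite (X \<inter> \<Inter>\<F> \<inter> C)" for C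
  proof -
    have "infinite (X \<inter> \<Inter>\<F>)" if "finite \<F>" "\<F> \<subseteq> insert C p" for \<F>
    proof
      assume "finite (X \<inter> \<Inter>\<F>)"
      moreover have "X \<inter> \<Inter>(\<F> - {C}) \<inter> C \<subseteq> X \<inter> \<Inter>\<F>" by blast
      ultimately show False using meets[of "\<F> - {C}"] that finite_subset by blast
    qed
    then have "insert C p \<in> Q" using p C by (auto simp: Q_def)
    then show ?thesis using max[of "insert C p"] by blast
  qed
  have sub: "B \<subseteq> X" if "B \<in> p" for B using p that by (auto simp: Q_def)
  have members_infinite: "infinite B" if "B \<in> p" for B
    using inf[of "{B}"] sub[OF that] that by (simp add: Int_absorb1)
  have "A \<inter> B \<in> p" if AB: "A \<in> p" "B \<in> p" for A B
  proof (rule member)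
    fix \<F> assume "finite \<F>" "\<F> \<subseteq> p"
    then have "infinite (X \<inter> \<Inter>(insert A (insert B \<F>)))" by (intro inf) (use AB in auto)
    moreover have "X \<inter> \<Inter>(insert A (insert B \<F>)) = X \<inter> \<Inter>\<F> \<inter> (A \<inter> B)" by blast
    ultimately show "infinite (X \<inter> \<Inter>\<F> \<inter> (A \<inter> B))" by simp
  qed (use sub AB in blast)
  moreover have "B \<in> p" if AB: "A \<in> p" "A \<subseteq> B" "B \<subseteq> X" for A B
  proof (rule member)
    fix \<F> assume "finite \<F>" "\<F> \<subseteq> p"
    then have "infinite (X \<inter> \<Inter>(insert A \<F>))" by (intro inf) (use AB in auto)
    moreover have "X \<inter> \<Inter>(insert A \<F>) \<subseteq> X \<inter> \<Inter>\<F> \<inter> B" using AB by blast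
    ultimately show "infinite (X \<inter> \<Inter>\<F> \<inter> B)" using finite_subset by blast
  qed (use AB in blast)
  moreover have "A \<in> p \<or> X - A \<in> p" if A: "A \<subseteq> X" for A
  proof (rule ccontr)
    assume "\<not> (A \<in> p \<or> X - A \<in> p)"
    then obtain \<F> \<F>' where F: "finite \<F>" "\<F> \<subseteq> p" "finite (X \<inter> \<Inter>\<F> \<inter> A)"
      and F': "finite \<F>'" "\<F>' \<subseteq> p" "finite (X \<inter> \<Inter>\<F>' \<inter> (X - A))"
      using member[of A] member[of "X - A"] A by blast
    have "X \<inter> \<Inter>(\<F> \<union> \<F>') \<subseteq> (X \<inter> \<Inter>\<F> \<inter> A) \<union> (X \<inter> \<Inter>\<F>' \<inter> (X - A))" by blast
    then have "finite (X \<inter> \<Inter>(\<F> \<union> \<F>'))" using F F' finite_subset by blast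
    then show False using inf[of "\<F> \<union> \<F>'"] F F' by blast
  qed
  moreover have "X \<in> p"
  proof (rule member)
    fix \<F> assume "finite \<F>" "\<F> \<subseteq> p"
    then show "infinite (X \<inter> \<Inter>\<F> \<inter> X)" using inf by (simp add: Int_absorb2 Int_commute)
  qed simp
  moreover have "{} \<notin> p" using members_infinite by blast
  moreover have "p \<subseteq> Pow X" using sub by blast
  ultimately have "ultrafilter_on X p"
    unfolding ultrafilter_on_def by (intro conjI) auto
  then have "p \<in> free_ultrafilters X"
    using members_infinite by (simp add: free_ultrafilter_iff_members_infinite)
  then show thesis using that p by (auto simp: Q_def)
qed

section \<open>Translates of ultrafilters and companions\<close>

context group
begin

lemma l_coset_inv_eq_preimage:
  assumes "g \<in> carrier G" "B \<subseteq> carrier G"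
  shows "inv g <# B = {x \<in> carrier G. g \<otimes> x \<in> B}"
proof -
  have "inv g \<otimes> (g \<otimes> x) = x" if "x \<in> carrier G" for x
    using that assms by (simp flip: m_assoc)
  moreover have "g \<otimes> (inv g \<otimes> b) = b" if "b \<in> B" for b
    using that assms(1) subsetD[OF assms(2) that] by (simp flip: m_assoc)
  ultimately show ?thesis
    using assms unfolding l_coset_def by (auto intro: bexI[where x = "g \<otimes> _"])
qed

lemma mem_translate_ultrafilter:
  assumes "g \<in> carrier G"
  shows "B \<in> translate_ultrafilter G g p \<longleftrightarrow>
    B \<subseteq> carrier G \<and> {x \<in> carrier G. g \<otimes> x \<in> B} \<in> p"
  using assms by (auto simp: translate_ultrafilter_def l_coset_inv_eq_preimage)

lemma translate_free_ultrafilter: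
  assumes g: "g \<in> carrier G" and p: "p \<in> free_ultrafilters (carrier G)"
  shows "translate_ultrafilter G g p \<in> free_ultrafilters (carrier G)"
proof -
  let ?pre = "\<lambda>B. {x \<in> carrier G. g \<otimes> x \<in> B}"
  have u: "ultrafilter_on (carrier G) p" and inf: "\<And>B. B \<in> p \<Longrightarrow> infinite B"
    using p by (auto simp: free_ultrafilter_iff_members_infinite)
  have "?pre (carrier G) = carrier G" using g by auto
  then have "carrier G \<in> translate_ultrafilter G g p"
    using ultrafilter_carrier[OF u] g by (simp add: mem_translate_ultrafilter)
  moreover have "{} \<notin> translate_ultrafilter G g p"
    using ultrafilter_empty[OF u] g by (simp add: mem_translate_ultrafilter)
  moreover have "A \<inter> B \<in> translate_ultrafilter G g p"
    if "A \<in> translate_ultrafilter G g p" "B \<in> translate_ultrafilter G g p" for A B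
  proof -
    have "?pre A \<in> p" "?pre B \<in> p"
      using that g by (auto simp: mem_translate_ultrafilter)
    then have "?pre A \<inter> ?pre B \<in> p" by (rule ultrafilter_Int[OF u])
    moreover have "?pre (A \<inter> B) = ?pre A \<inter> ?pre B" by blast
    ultimately show ?thesis using that g by (auto simp: mem_translate_ultrafilter)
  qed
  moreover have "B \<in> translate_ultrafilter G g p"
    if "A \<in> translate_ultrafilter G g p" "A \<subseteq> B" "B \<subseteq> carrier G" for A B
  proof -
    have "?pre A \<in> p" "?pre A \<subseteq> ?pre B" "?pre B \<subseteq> carrier G"
      using that g by (auto simp: mem_translate_ultrafilter)
    then have "?pre B \<in> p" by (rule ultrafilter_mono[OF u])
    then show ?thesis using that g by (simp add: mem_translate_ultrafilter)
  qed
  moreover have "A \<in> translate_ultrafilter G g p \<or> carrier G - A \<in> translate_ultrafilter G g p"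
    if "A \<subseteq> carrier G" for A
  proof -
    have "?pre A \<subseteq> carrier G" by blast
    then have "?pre A \<in> p \<or> carrier G - ?pre A \<in> p"
      by (rule ultrafilter_dichotomy[OF u])
    moreover have "carrier G - ?pre A = ?pre (carrier G - A)" using g by auto
    ultimately show ?thesis using that g by (simp add: mem_translate_ultrafilter)
  qed
  moreover have "infinite B" if "B \<in> translate_ultrafilter G g p" for B
  proof
    assume "finite B"
    moreover have "(\<otimes>) g ` ?pre B \<subseteq> B" by auto
    ultimately have "finite ((\<otimes>) g ` ?pre B)" by (rule finite_subset[rotated])
    moreover have "inj_on ((\<otimes>) g) (?pre B)" using g by (auto intro: inj_onI)
    ultimately have "finite (?pre B)" by (rule finite_imageD)
    then show False using inf that g by (auto simp: mem_translate_ultrafilter)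
  qed
  moreover have "translate_ultrafilter G g p \<subseteq> Pow (carrier G)"
    by (auto simp: translate_ultrafilter_def)
  ultimately show ?thesis
    unfolding free_ultrafilter_iff_members_infinite ultrafilter_on_def by (intro conjI) auto
qed

lemma companion_eq:
  assumes "p \<in> free_ultrafilters (carrier G)"
  shows "companion G p A = {q \<in> ultrafilter_orbit G p. A \<in> q}"
  using translate_free_ultrafilter[OF _ assms]
  by (auto simp: companion_def free_ultrafilters_containing_def ultrafilter_orbit_def
      free_ultrafilters_def)

lemma companion_eq_orbit_iff:
  assumes "p \<in> free_ultrafilters (carrier G)" "A \<subseteq> carrier G"
  shows "companion G p A = ultrafilter_orbit G p \<longleftrightarrow>
    (\<forall>g\<in>carrier G. {x \<in> carrier G. g \<otimes> x \<in> A} \<in> p)"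
proof -
  have "companion G p A = ultrafilter_orbit G p \<longleftrightarrow> (\<forall>q\<in>ultrafilter_orbit G p. A \<in> q)"
    unfolding companion_eq[OF assms(1)] by blast
  also have "\<dots> \<longleftrightarrow> (\<forall>g\<in>carrier G. {x \<in> carrier G. g \<otimes> x \<in> A} \<in> p)"
    using assms(2) by (simp add: ultrafilter_orbit_def mem_translate_ultrafilter)
  finally show ?thesis .
qed

section \<open>Thick and prethick sets\<close>

text \<open>Applying thickness to \<open>FH\<close> yields an \<open>a\<close> with \<open>F(Ha) \<subseteq> A\<close>, and \<open>Ha\<close> has as many elements as \<open>H\<close>.\<close>

lemma thick_infinitely_many:
  assumes "infinite (carrier G)" "A \<subseteq> carrier G" "thick G A"
    and F: "finite F" "F \<subseteq> carrier G"
  shows "infinite {x \<in> carrier G. \<forall>f\<in>F. f \<otimes> x \<in> A}" (is "infinite ?S")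
proof
  assume fin: "finite ?S"
  obtain H where H: "H \<subseteq> carrier G" "finite H" "card H = Suc (card ?S)"
    using infinite_arbitrarily_large[OF assms(1)] by blast
  have "finite (F <#> H)" "F <#> H \<subseteq> carrier G"
    using F H by (auto simp: set_mult_def)
  then obtain a where a: "a \<in> A" "(F <#> H) #> a \<subseteq> A"
    using assms(3) unfolding thick_def by blast
  have ac: "a \<in> carrier G" using a assms(2) by blast
  have "(\<lambda>h. h \<otimes> a) ` H \<subseteq> ?S"
  proof (clarify, intro conjI ballI)
    fix h assume h: "h \<in> H"
    then show "h \<otimes> a \<in> carrier G" using H ac by blast
    fix f assume f: "f \<in> F"
    have "f \<otimes> h \<otimes> a \<in> (F <#> H) #> a"
      using h f by (auto simp: set_mult_def r_coset_def)
    then show "f \<otimes> (h \<otimes> a) \<in> A" using a(2) h f H(1) F(2) ac m_assoc by fastforce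
  qed
  then have "card ((\<lambda>h. h \<otimes> a) ` H) \<le> card ?S" by (rule card_mono[OF fin])
  moreover have "inj_on (\<lambda>h. h \<otimes> a) H" using H(1) ac by (auto intro!: inj_onI simp: subset_iff)
  ultimately show False using H(3) by (simp add: card_image)
qed

lemma thick_iff_companion_eq_orbit:
  assumes A: "A \<subseteq> carrier G" "infinite A"
  shows "thick G A \<longleftrightarrow>
    (\<exists>p\<in>free_ultrafilters (carrier G). companion G p A = ultrafilter_orbit G p)"
proof
  let ?pre = "\<lambda>g. {x \<in> carrier G. g \<otimes> x \<in> A}"
  assume thick: "thick G A"
  have inf: "infinite (carrier G)" using A infinite_super by blast
  obtain p where p: "p \<in> free_ultrafilters (carrier G)" "?pre ` carrier G \<subseteq> p"
  proof (rule free_ultrafilter_extending)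
    fix \<F> assume "finite \<F>" "\<F> \<subseteq> ?pre ` carrier G"
    then obtain F where F: "finite F" "F \<subseteq> carrier G" "\<F> = ?pre ` F"
      by (meson finite_subset_image)
    have "carrier G \<inter> \<Inter>\<F> = {x \<in> carrier G. \<forall>f\<in>F. f \<otimes> x \<in> A}" using F by auto
    then show "infinite (carrier G \<inter> \<Inter>\<F>)"
      using thick_infinitely_many[OF inf A(1) thick F(1,2)] by simp
  qed auto
  then show "\<exists>p\<in>free_ultrafilters (carrier G). companion G p A = ultrafilter_orbit G p"
    using companion_eq_orbit_iff[OF _ A(1)] by blast
next
  let ?pre = "\<lambda>g. {x \<in> carrier G. g \<otimes> x \<in> A}"
  assume "\<exists>p\<in>free_ultrafilters (carrier G). companion G p A = ultrafilter_orbit G p"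
  then obtain p where p: "p \<in> free_ultrafilters (carrier G)" "\<And>g. g \<in> carrier G \<Longrightarrow> ?pre g \<in> p"
    using companion_eq_orbit_iff[OF _ A(1)] by blast
  have u: "ultrafilter_on (carrier G) p" using p by (simp add: free_ultrafilter_iff_members_infinite)
  show "thick G A"
    unfolding thick_def
  proof (intro allI impI, elim conjE)
    fix F assume F: "finite F" "F \<subseteq> carrier G"
    \<comment> \<open>The element \<open>\<one>\<close> is added to \<open>F\<close> so that the point found lies in \<open>A\<close> itself.\<close>
    have "carrier G \<inter> \<Inter>(?pre ` insert \<one> F) \<in> p"
      using F p by (intro ultrafilter_finite_Inter[OF u]) auto
    then have "carrier G \<inter> \<Inter>(?pre ` insert \<one> F) \<noteq> {}" using ultrafilter_empty[OF u] by metis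
    then obtain a where a: "a \<in> carrier G" "\<forall>f\<in>insert \<one> F. f \<otimes> a \<in> A" by blast
    then show "\<exists>a\<in>A. F #> a \<subseteq> A" by (intro bexI[of _ a]) (auto simp: r_coset_def)
  qed
qed

lemma infinite_set_mult:
  assumes "F \<noteq> {}" "F \<subseteq> carrier G" "A \<subseteq> carrier G" "infinite A"
  shows "infinite (F <#> A)"
proof
  assume fin: "finite (F <#> A)"
  obtain f where f: "f \<in> F" using assms(1) by blast
  have "(\<otimes>) f ` A \<subseteq> F <#> A" using f by (auto simp: set_mult_def)
  then have "finite ((\<otimes>) f ` A)" using fin finite_subset by blast
  moreover have "inj_on ((\<otimes>) f) A" using f assms(2,3) by (auto intro!: inj_onI simp: subset_iff)
  ultimately show False using assms(4) finite_imageD by blast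
qed

text \<open>
  For nonempty \<open>F\<close> the set \<open>FA\<close> is infinite and the criterion for thick sets applies to it. For
  \<open>F = {}\<close> both sides fail, as the empty set is not thick and belongs to no ultrafilter.
\<close>

lemma prethick_iff_companion_eq_orbit:
  assumes A: "A \<subseteq> carrier G" "infinite A"
  shows "prethick G A \<longleftrightarrow>
    (\<exists>p\<in>free_ultrafilters (carrier G). \<exists>F. finite F \<and> F \<subseteq> carrier G \<and>
       companion G p (F <#> A) = ultrafilter_orbit G p)"
proof -
  have "thick G (F <#> A) \<longleftrightarrow>
    (\<exists>p\<in>free_ultrafilters (carrier G). companion G p (F <#> A) = ultrafilter_orbit G p)"
    if F: "F \<subseteq> carrier G" for F
  proof (cases "F = {}")
    case True
    have "\<not> thick G ({} <#> A)" by (auto simp: thick_def set_mult_def)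
    moreover have "companion G p ({} <#> A) \<noteq> ultrafilter_orbit G p"
      if p: "p \<in> free_ultrafilters (carrier G)" for p
    proof -
      have "{} \<notin> p"
        using p ultrafilter_empty by (auto simp: free_ultrafilter_iff_members_infinite)
      then show ?thesis using companion_eq_orbit_iff[OF p, of "{}"] by (auto simp: set_mult_def)
    qed
    ultimately show ?thesis using True by blast
  next
    case False
    then show ?thesis
      using thick_iff_companion_eq_orbit infinite_set_mult[OF False F A]
        set_mult_closed[OF F A(1)] by blast
  qed
  then have "prethick G A \<longleftrightarrow> (\<exists>F. finite F \<and> F \<subseteq> carrier G \<and>
    (\<exists>p\<in>free_ultrafilters (carrier G). companion G p (F <#> A) = ultrafilter_orbit G p))"
    by (simp add: prethick_def cong: conj_cong)
  then show ?thesis by metis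
qed

section \<open>Small sets\<close>

lemma thick_mono:
  assumes "thick G A" "A \<subseteq> B" shows "thick G B"
  using assms unfolding thick_def by (meson subset_eq)

text \<open>
  If \<open>F\<^sup>-\<^sup>1(G \<setminus> A)\<close> is not all of \<open>G\<close>, then a point \<open>x\<close> outside it satisfies \<open>Fx \<subseteq> A\<close>; and if it is
  all of \<open>G\<close>, no such \<open>x\<close> exists.
\<close>

lemma thick_iff_complement_not_large:
  assumes A: "A \<subseteq> carrier G"
  shows "thick G A \<longleftrightarrow> \<not> large G (carrier G - A)"
proof
  assume thick: "thick G A"
  show "\<not> large G (carrier G - A)"
  proof
    assume "large G (carrier G - A)"
    then obtain K where K: "finite K" "K \<subseteq> carrier G" "carrier G = K <#> (carrier G - A)"
      unfolding large_def by blast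
    have "finite (m_inv G ` K)" "m_inv G ` K \<subseteq> carrier G" using K by auto
    then obtain a where a: "a \<in> A" "(m_inv G ` K) #> a \<subseteq> A"
      using thick unfolding thick_def by blast
    have ac: "a \<in> carrier G" using a A by blast
    then obtain k l where kl: "k \<in> K" "l \<in> carrier G - A" "a = k \<otimes> l"
      using K(3) unfolding set_mult_def by blast
    have kc: "k \<in> carrier G" using kl K by blast
    then have "inv k \<otimes> a = l" using kl kc by (simp flip: m_assoc)
    moreover have "inv k \<otimes> a \<in> A" using a kl by (auto simp: r_coset_def)
    ultimately show False using kl by blast
  qed
next
  assume nl: "\<not> large G (carrier G - A)"
  show "thick G A"
    unfolding thick_def
  proof (intro allI impI, elim conjE)
    fix F assume F: "finite F" "F \<subseteq> carrier G"
    \<comment> \<open>As above, \<open>\<one>\<close> is added so that the point found lies in \<open>A\<close>.\<close>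
    let ?K = "m_inv G ` insert \<one> F"
    have K: "finite ?K" "?K \<subseteq> carrier G" using F by auto
    moreover have "?K <#> (carrier G - A) \<subseteq> carrier G"
      using K by (intro set_mult_closed) auto
    ultimately obtain x where x: "x \<in> carrier G" "x \<notin> ?K <#> (carrier G - A)"
      using nl unfolding large_def by blast
    have mem: "f \<otimes> x \<in> A" if f: "f \<in> insert \<one> F" for f
    proof (rule ccontr)
      assume n: "f \<otimes> x \<notin> A"
      have fc: "f \<in> carrier G" using f F by auto
      then have "inv f \<otimes> (f \<otimes> x) = x" using x by (simp flip: m_assoc)
      moreover have "inv f \<otimes> (f \<otimes> x) \<in> ?K <#> (carrier G - A)"
        unfolding set_mult_def using f n fc x by blast
      ultimately show False using x by simp
    qed
    have "x \<in> A" using mem[of \<one>] x(1) by simp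
    moreover have "F #> x \<subseteq> A" using mem by (auto simp: r_coset_def)
    ultimately show "\<exists>a\<in>A. F #> a \<subseteq> A" by blast
  qed
qed

lemma large_if_set_mult_large:
  assumes "finite K" "K \<subseteq> carrier G" "B \<subseteq> carrier G" "large G (K <#> B)"
  shows "large G B"
proof -
  obtain F where F: "finite F" "F \<subseteq> carrier G" "carrier G = F <#> (K <#> B)"
    using assms(4) unfolding large_def by blast
  then have "carrier G = (F <#> K) <#> B" using set_mult_assoc[OF F(2) assms(2,3)] by metis
  moreover have "finite (F <#> K)" using F assms by (auto simp: set_mult_def)
  moreover have "F <#> K \<subseteq> carrier G" using F(2) assms(2) by (rule set_mult_closed)
  ultimately show ?thesis unfolding large_def by blast
qed

lemma large_l_coset:
  assumes "g \<in> carrier G" "L \<subseteq> carrier G" "large G L"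
  shows "large G (g <# L)"
proof (rule large_if_set_mult_large)
  have "{inv g} <#> (g <# L) = inv g <# (g <# L)" by (auto simp: set_mult_def l_coset_def)
  also have "\<dots> = L" using assms by (simp add: lcos_m_assoc lcos_mult_one)
  finally show "large G ({inv g} <#> (g <# L))" using assms by simp
qed (use assms in \<open>auto simp: l_coset_subset_G\<close>)

lemma small_Un:
  assumes "small G A" "small G B" shows "small G (A \<union> B)"
proof -
  have "L - (A \<union> B) = (L - A) - B" for L by blast
  then show ?thesis using assms unfolding small_def by (metis Diff_subset subset_trans)
qed

lemma small_l_coset:
  assumes g: "g \<in> carrier G" and A: "A \<subseteq> carrier G" "small G A"
  shows "small G (g <# A)"
  unfolding small_def
proof (intro allI impI, elim conjE)
  fix L assume L: "L \<subseteq> carrier G" "large G L"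
  have L': "inv g <# L \<subseteq> carrier G" "large G (inv g <# L)"
    using g L by (auto simp: l_coset_subset_G large_l_coset)
  have "L - (g <# A) = (g <# (inv g <# L)) - (g <# A)"
    using g L by (simp add: lcos_m_assoc lcos_mult_one)
  also have "\<dots> = g <# ((inv g <# L) - A)"
  proof -
    have image: "g <# B = (\<otimes>) g ` B" for B by (auto simp: l_coset_def)
    have "inj_on ((\<otimes>) g) (carrier G)" using g by (auto intro: inj_onI)
    then show ?thesis
      unfolding image using A L'(1) by (intro inj_on_image_set_diff[symmetric]) auto
  qed
  finally show "large G (L - (g <# A))"
    using g A L' by (auto simp: small_def intro: large_l_coset)
qed

text \<open>
  If \<open>L\<close> is large, say \<open>G = KL\<close>, but \<open>L \<setminus> A\<close> is not, then neither is \<open>K(L \<setminus> A)\<close>, so its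
  complement is thick; and that complement lies in \<open>KA\<close>. Conversely, smallness passes
  to translates and finite unions, hence from \<open>A\<close> to \<open>FA\<close>; then \<open>G \<setminus> FA\<close> is large, so \<open>FA\<close> is not
  thick.
\<close>

lemma small_iff_not_prethick:
  assumes A: "A \<subseteq> carrier G"
  shows "small G A \<longleftrightarrow> \<not> prethick G A"
proof
  assume small: "small G A"
  have "large G (carrier G)"
    unfolding large_def by (intro exI[of _ "{\<one>}"]) (auto simp: set_mult_def)
  have "\<not> thick G (F <#> A)" if F: "finite F" "F \<subseteq> carrier G" for F
  proof -
    have "small G (F <#> A)"
      using F
    proof (induction F)
      case empty
      show ?case by (simp add: small_def set_mult_def)
    next
      case (insert f F)
      have "insert f F <#> A = (f <# A) \<union> (F <#> A)"
        by (auto simp: set_mult_def l_coset_def)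
      then show ?case using insert small A by (simp add: small_Un small_l_coset)
    qed
    then have "large G (carrier G - (F <#> A))"
      using \<open>large G (carrier G)\<close> by (simp add: small_def)
    then show ?thesis using thick_iff_complement_not_large set_mult_closed F A by blast
  qed
  then show "\<not> prethick G A" unfolding prethick_def by blast
next
  assume np: "\<not> prethick G A"
  show "small G A"
  proof (rule ccontr)
    assume "\<not> small G A"
    then obtain L where L: "L \<subseteq> carrier G" "large G L" "\<not> large G (L - A)"
      unfolding small_def by blast
    obtain K where K: "finite K" "K \<subseteq> carrier G" "carrier G = K <#> L"
      using L unfolding large_def by blast
    let ?B = "K <#> (L - A)"
    have B: "?B \<subseteq> carrier G" using K L by (intro set_mult_closed) auto
    have "\<not> large G ?B" using large_if_set_mult_large[of K "L - A"] K L by blast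
    then have "thick G (carrier G - ?B)"
      using thick_iff_complement_not_large[of "carrier G - ?B"] B by (simp add: double_diff)
    moreover have "carrier G - ?B \<subseteq> K <#> A"
    proof
      fix x assume x: "x \<in> carrier G - ?B"
      then have "x \<in> K <#> L" using K(3) by simp
      then obtain k l where kl: "k \<in> K" "l \<in> L" "x = k \<otimes> l"
        unfolding set_mult_def by blast
      then have "l \<in> A" using x unfolding set_mult_def by blast
      then show "x \<in> K <#> A" using kl unfolding set_mult_def by blast
    qed
    ultimately have "thick G (K <#> A)" by (rule thick_mono)
    then show False using np K(1,2) unfolding prethick_def by blast
  qed
qed

section \<open>Thin sets\<close>

text \<open>
  A maximal subset \<open>C\<close> of \<open>B\<close> disjoint from \<open>gC\<close> cannot be finite: any point of \<open>B\<close>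
  outside the finite set \<open>C \<union> gC \<union> g\<^sup>-\<^sup>1C\<close> could be added to it, as \<open>g\<close> has no fixed points.
\<close>

lemma infinite_displaced_subset:
  assumes g: "g \<in> carrier G" "g \<noteq> \<one>" and B: "B \<subseteq> carrier G" "infinite B"
  obtains C where "C \<subseteq> B" "infinite C" "(g <# C) \<inter> C = {}"
proof -
  define Q where "Q = {C. C \<subseteq> B \<and> (g <# C) \<inter> C = {}}"
  have "\<exists>M\<in>Q. \<forall>C\<in>Q. M \<subseteq> C \<longrightarrow> C = M"
  proof (rule subset_Zorn_nonempty)
    have "{} \<in> Q" by (simp add: Q_def)
    then show "Q \<noteq> {}" by blast
  next
    fix \<C> assume "\<C> \<noteq> {}" and chain: "subset.chain Q \<C>"
    have "g \<otimes> x \<notin> \<Union>\<C>" if x: "x \<in> \<Union>\<C>" for x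
    proof
      assume "g \<otimes> x \<in> \<Union>\<C>"
      then have "finite {x, g \<otimes> x}" "{x, g \<otimes> x} \<subseteq> \<Union>\<C>" using x by auto
      then obtain C where "C \<in> \<C>" "{x, g \<otimes> x} \<subseteq> C"
        using finite_subset_Union_chain[OF _ _ \<open>\<C> \<noteq> {}\<close> chain] by metis
      moreover from this have "(g <# C) \<inter> C = {}"
        using chain unfolding subset.chain_def Q_def by blast
      ultimately show False unfolding l_coset_def by blast
    qed
    moreover have "\<Union>\<C> \<subseteq> B" using chain unfolding subset.chain_def Q_def by blast
    ultimately show "\<Union>\<C> \<in> Q" unfolding Q_def l_coset_def by blast
  qed
  then obtain C where C: "C \<in> Q" and max: "\<And>D. \<lbrakk>D \<in> Q; C \<subseteq> D\<rbrakk> \<Longrightarrow> D = C" by blast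
  have "infinite C"
  proof
    assume "finite C"
    then have "finite (C \<union> (g <# C) \<union> (inv g <# C))" by (simp add: l_coset_def)
    then have "\<not> B \<subseteq> C \<union> (g <# C) \<union> (inv g <# C)" using B(2) finite_subset by blast
    then obtain x where x: "x \<in> B" "x \<notin> C" "x \<notin> g <# C" "x \<notin> inv g <# C" by blast
    have xc: "x \<in> carrier G" and Cc: "C \<subseteq> carrier G" using x B C by (auto simp: Q_def)
    have "g \<otimes> x \<notin> C" using x xc g Cc by (simp add: l_coset_inv_eq_preimage)
    moreover have "g \<otimes> x \<noteq> x" using g xc by simp
    ultimately have "(g <# insert x C) \<inter> insert x C = {}"
      using C x unfolding Q_def l_coset_def by blast
    then have "insert x C \<in> Q" using C x by (simp add: Q_def)
    then show False using max[of "insert x C"] x by blast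
  qed
  then show thesis using that C by (auto simp: Q_def)
qed

text \<open>
  With \<open>q = gp\<close> and \<open>r = hp\<close>, the set of \<open>x\<close> with \<open>gx\<close> and \<open>hx\<close> both in \<open>A\<close> is infinite, and
  \<open>gx = (gh\<^sup>-\<^sup>1)(hx)\<close> lies in \<open>gh\<^sup>-\<^sup>1A \<inter> A\<close>. Thinness leaves only \<open>g = h\<close>.
\<close>

lemma thin_imp_companion_unique:
  assumes thin: "thin G A"
    and p: "p \<in> free_ultrafilters (carrier G)"
    and q: "q \<in> companion G p A" and r: "r \<in> companion G p A"
  shows "q = r"
proof -
  have u: "ultrafilter_on (carrier G) p" and inf: "\<And>B. B \<in> p \<Longrightarrow> infinite B"
    using p by (auto simp: free_ultrafilter_iff_members_infinite)
  obtain g h where g: "g \<in> carrier G" "q = translate_ultrafilter G g p" "A \<in> q"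
    and h: "h \<in> carrier G" "r = translate_ultrafilter G h p" "A \<in> r"
    using q r unfolding companion_eq[OF p] ultrafilter_orbit_def by blast
  let ?S = "{x \<in> carrier G. g \<otimes> x \<in> A} \<inter> {x \<in> carrier G. h \<otimes> x \<in> A}"
  have "?S \<in> p"
    by (rule ultrafilter_Int[OF u]) (use g h in \<open>simp_all add: mem_translate_ultrafilter\<close>)
  then have "infinite ?S" by (rule inf)
  moreover have "inj_on ((\<otimes>) g) ?S" using g by (auto intro: inj_onI)
  ultimately have "infinite ((\<otimes>) g ` ?S)" using finite_imageD by blast
  moreover have "(\<otimes>) g ` ?S \<subseteq> ((g \<otimes> inv h) <# A) \<inter> A"
  proof (rule image_subsetI)
    fix x assume "x \<in> ?S"
    then have x: "x \<in> carrier G" "g \<otimes> x \<in> A" "h \<otimes> x \<in> A" by auto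
    have "inv h \<otimes> (h \<otimes> x) = x" using x h by (simp flip: m_assoc)
    then have "g \<otimes> x = (g \<otimes> inv h) \<otimes> (h \<otimes> x)" using x g h by (simp add: m_assoc)
    then have "g \<otimes> x \<in> (g \<otimes> inv h) <# A" using x unfolding l_coset_def by blast
    then show "g \<otimes> x \<in> ((g \<otimes> inv h) <# A) \<inter> A" using x by blast
  qed
  ultimately have "infinite (((g \<otimes> inv h) <# A) \<inter> A)" using finite_subset by blast
  then have "g \<otimes> inv h = \<one>" using thin g h unfolding thin_def by blast
  then have "g = h" using g h by (metis inv_closed inv_equality inv_inv)
  then show ?thesis using g h by simp
qed

text \<open>
  The two members of \<open>\<Delta>\<^sub>q(A)\<close> obtained from an infinite \<open>gA \<inter> A\<close> are \<open>q\<close> and \<open>g\<^sup>-\<^sup>1q\<close>. They can coincide for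
  no \<open>q\<close> containing a set \<open>C\<close> disjoint from \<open>gC\<close>, since \<open>C \<in> g\<^sup>-\<^sup>1q\<close> means \<open>gC \<in> q\<close>.
\<close>

lemma companion_unique_imp_thin:
  assumes A: "A \<subseteq> carrier G"
    and unique: "\<And>p q r. \<lbrakk>p \<in> free_ultrafilters (carrier G); q \<in> companion G p A;
      r \<in> companion G p A\<rbrakk> \<Longrightarrow> q = r"
  shows "thin G A"
  unfolding thin_def
proof (intro ballI, rule ccontr)
  fix g assume "g \<in> carrier G - {\<one>}" and inf: "infinite ((g <# A) \<inter> A)"
  then have g: "g \<in> carrier G" "g \<noteq> \<one>" by auto
  obtain C where C: "C \<subseteq> (g <# A) \<inter> A" "infinite C" "(g <# C) \<inter> C = {}"
    using infinite_displaced_subset[OF g _ inf] A by blast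
  have Cc: "C \<subseteq> carrier G" using C A by blast
  obtain q where q: "q \<in> free_ultrafilters (carrier G)" "{C} \<subseteq> q"
  proof (rule free_ultrafilter_extending)
    fix \<F> assume "finite \<F>" "\<F> \<subseteq> {C}"
    then have "C \<subseteq> carrier G \<inter> \<Inter>\<F>" using Cc by blast
    then show "infinite (carrier G \<inter> \<Inter>\<F>)" using C(2) infinite_super by blast
  qed (use Cc in auto)
  have u: "ultrafilter_on (carrier G) q" using q by (simp add: free_ultrafilter_iff_members_infinite)
  have "g <# A \<subseteq> carrier G" using g A by (simp add: l_coset_subset_G)
  then have "A \<in> q" "g <# A \<in> q"
    using q C A by (auto intro: ultrafilter_mono[OF u, of C])
  let ?r = "translate_ultrafilter G (inv g) q"
  have translate_one: "translate_ultrafilter G \<one> q = q"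
    using ultrafilter_subset[OF u] by (auto simp: translate_ultrafilter_def lcos_mult_one)
  have "q \<in> companion G q A"
    using \<open>A \<in> q\<close> translate_one unfolding companion_eq[OF q(1)] ultrafilter_orbit_def by force
  moreover have "?r \<in> companion G q A"
  proof -
    have "?r \<in> ultrafilter_orbit G q" using g by (simp add: ultrafilter_orbit_def)
    moreover have "A \<in> ?r"
      using \<open>g <# A \<in> q\<close> g A by (simp add: translate_ultrafilter_def)
    ultimately show ?thesis by (simp add: companion_eq[OF q(1)])
  qed
  ultimately have "q = ?r" using unique q(1) by blast
  then have "C \<in> ?r" using q by blast
  then have "g <# C \<in> q" using g by (simp add: translate_ultrafilter_def)
  then have "(g <# C) \<inter> C \<in> q" using q by (auto intro: ultrafilter_Int[OF u])
  then show False using C ultrafilter_empty[OF u] by simp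
qed

lemma thin_iff_companion_le_one:
  assumes "A \<subseteq> carrier G"
  shows "thin G A \<longleftrightarrow> (\<forall>p\<in>free_ultrafilters (carrier G).
    finite (companion G p A) \<and> card (companion G p A) \<le> 1)"
proof
  assume thin: "thin G A"
  show "\<forall>p\<in>free_ultrafilters (carrier G).
    finite (companion G p A) \<and> card (companion G p A) \<le> 1"
  proof
    fix p assume p: "p \<in> free_ultrafilters (carrier G)"
    have unique: "\<And>q r. \<lbrakk>q \<in> companion G p A; r \<in> companion G p A\<rbrakk> \<Longrightarrow> q = r"
      by (rule thin_imp_companion_unique[OF thin p])
    have "\<exists>q. companion G p A \<subseteq> {q}" using unique by blast
    then have "finite (companion G p A)" using finite_subset by blast
    then show "finite (companion G p A) \<and> card (companion G p A) \<le> 1"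
      using unique by (simp add: card_le_Suc0_iff_eq)
  qed
next
  assume le: "\<forall>p\<in>free_ultrafilters (carrier G).
    finite (companion G p A) \<and> card (companion G p A) \<le> 1"
  show "thin G A"
  proof (rule companion_unique_imp_thin[OF assms])
    fix p q r
    assume "p \<in> free_ultrafilters (carrier G)" "q \<in> companion G p A" "r \<in> companion G p A"
    moreover from this have "finite (companion G p A)" "card (companion G p A) \<le> Suc 0"
      using le by auto
    ultimately show "q = r" by (simp add: card_le_Suc0_iff_eq)
  qed
qed

end

theorem proposition3:
  fixes G :: "('a, 'b) monoid_scheme" and A :: "'a set"
  assumes "group G" and "A \<subseteq> carrier G" and "infinite A"
  shows
    "(thick G A \<longleftrightarrow>
        (\<exists>p \<in> free_ultrafilters (carrier G). companion G p A = ultrafilter_orbit G p)) \<and>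
     (prethick G A \<longleftrightarrow>
        (\<exists>p \<in> free_ultrafilters (carrier G). \<exists>F. finite F \<and> F \<subseteq> carrier G \<and>
           companion G p (F <#>\<^bsub>G\<^esub> A) = ultrafilter_orbit G p)) \<and>
     (small G A \<longleftrightarrow>
        (\<forall>p \<in> free_ultrafilters (carrier G). \<forall>F. finite F \<and> F \<subseteq> carrier G \<longrightarrow>
           companion G p (F <#>\<^bsub>G\<^esub> A) \<noteq> ultrafilter_orbit G p)) \<and>
     (thin G A \<longleftrightarrow>
        (\<forall>p \<in> free_ultrafilters (carrier G).
           finite (companion G p A) \<and> card (companion G p A) \<le> 1))"
proof -
  interpret group G by fact
  have prethick: "prethick G A \<longleftrightarrow>
    (\<exists>p\<in>free_ultrafilters (carrier G). \<exists>F. finite F \<and> F \<subseteq> carrier G \<and>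
       companion G p (F <#>\<^bsub>G\<^esub> A) = ultrafilter_orbit G p)"
    using assms(2,3) by (rule prethick_iff_companion_eq_orbit)
  moreover have "small G A \<longleftrightarrow>
    (\<forall>p\<in>free_ultrafilters (carrier G). \<forall>F. finite F \<and> F \<subseteq> carrier G \<longrightarrow>
       companion G p (F <#>\<^bsub>G\<^esub> A) \<noteq> ultrafilter_orbit G p)"
    unfolding small_iff_not_prethick[OF assms(2)] prethick by blast
  ultimately show ?thesis
    using thick_iff_companion_eq_orbit[OF assms(2,3)] thin_iff_companion_le_one[OF assms(2)]
    by (intro conjI)
qed

end
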